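(* Let $Q\subset \mathrm{GL}(n,\mathbb{R})$ be a closed subgroup of the form $Q=ANR$, where $A,N,R$ are Lie subgroups of $Q$ such that: (1) the map $A\times N\times R\ni (a,\nu,r)\mapsto a\nu r\in Q$ is a diffeomorphism; (2) $R$ is compact; (3) $A$ is abelian, and $A$ and $R$ commute; (4) both $R$ and $A$ normalize $N$; (5) with $\mathfrak{a}=\{X\in M(n,\mathbb{R})\mid \forall t\in\mathbb{R}: e^{tX}\in A\}$ the Lie algebra of $A$, the map $\exp:\mathfrak{a}\to A$ is an isomorphism of abelian groups. Let $H_1,\ldots,H_r$ be a basis of $\mathfrak{a}$ and let $\Gamma_A=\{\exp(\sum_{j=1}^r m_jH_j)\mid (m_1,\ldots,m_r)\in\mathbb{Z}^r\}$. Let $\Gamma_N$ be a discrete subgroup of $N$ and set $\Gamma=\Gamma_A\Gamma_N=\{\gamma\eta\mid \gamma\in\Gamma_A,\ \eta\in\Gamma_N\}$. Let $\mathcal{O}\subset\mathbb{R}^n$ be an open $Q$-orbit for the action $q\cdot v=(q^{-1})^T(v)$ such that $\overline{\mathcal{O}}\setminus\mathcal{O}$ has Lebesgue measure zero. Let $\omega\in\mathcal{O}$ and assume that the stabilizer $Q^\omega=\{q\in Q\mid q\cdot\omega=\omega\}$ is contained in $R$. Then $\Gamma$ is a separated set (for the action of $Q$ on $\mathcal{O}$).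
   Context: $a^T$ denotes the transpose of a matrix $a$. Definition (separated): let a locally compact Hausdorff topological group $G$ act on a locally compact Hausdorff space $X$, written $(g,x)\mapsto g\cdot x$. A subset $\Gamma\subset G$ is called separated if there is a compact set $B\subset X$ with nonempty interior such that $h\cdot B\cap k\cdot B=\emptyset$ for all $h,k\in\Gamma$ with $h\neq k$; one then says $\Gamma$ is separated by $B$. The set $\Gamma=\Gamma_A\Gamma_N$ need not be a subgroup. *)

theory Defs
  imports "HOL-Analysis.Analysis" "HOL-Algebra.Group_Action"
begin

section \<open>Smooth maps, diffeomorphisms and embedded submanifolds\<close>

text \<open>\<open>C_on k f U\<close> is meant for open \<open>U\<close>: all directional derivatives up to order \<open>k\<close> exist,
  as Frechet derivatives in a direction, and are continuous on \<open>U\<close>.\<close>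

primrec C_on ::
  "nat \<Rightarrow> ('a::real_normed_vector \<Rightarrow> 'b::real_normed_vector) \<Rightarrow> 'a set \<Rightarrow> bool" where
  "C_on 0 f U \<longleftrightarrow> continuous_on U f"
| "C_on (Suc k) f U \<longleftrightarrow>
     (\<forall>x\<in>U. f differentiable (at x)) \<and>
     (\<forall>v. C_on k (\<lambda>x. frechet_derivative f (at x) v) U)"

text \<open>Smoothness on an arbitrary subset of a Euclidean space is local extendability to a smooth
  function on an open set. For embedded submanifolds this is the usual notion of a smooth map.\<close>

definition smooth_map ::
  "'a::euclidean_space set \<Rightarrow> ('a \<Rightarrow> 'b::euclidean_space) \<Rightarrow> bool" where
  "smooth_map S f \<longleftrightarrow>
     (\<forall>x\<in>S. \<exists>U F. open U \<and> x \<in> U \<and> (\<forall>k. C_on k F U) \<and> (\<forall>y\<in>U \<inter> S. F y = f y))"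

definition diffeomorphism ::
  "'a::euclidean_space set \<Rightarrow> 'b::euclidean_space set \<Rightarrow> ('a \<Rightarrow> 'b) \<Rightarrow> bool" where
  "diffeomorphism S T f \<longleftrightarrow> (\<exists>g. homeomorphism S T f g \<and> smooth_map S f \<and> smooth_map T g)"

definition embedded_submanifold :: "'a::euclidean_space set \<Rightarrow> bool" where
  "embedded_submanifold M \<longleftrightarrow>
     (\<forall>x\<in>M. \<exists>U W V. \<exists>\<phi> :: 'a \<Rightarrow> 'a. open U \<and> x \<in> U \<and> open W \<and> diffeomorphism U W \<phi> \<and>
        subspace V \<and> \<phi> ` (U \<inter> M) = W \<inter> V)"


section \<open>Matrix groups\<close>

text \<open>The type \<open>real ^ 'n ^ 'n\<close> carries componentwise \<open>*\<close>, \<open>1\<close> and \<open>^\<close> in the library; the matrix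
  operations are \<open>**\<close>, \<open>mat 1\<close> and \<open>matrix_pow\<close>.\<close>

definition GL :: "(real ^ 'n ^ 'n) monoid" where
  "GL = \<lparr>carrier = {g. invertible g}, mult = (**), one = mat 1\<rparr>"

abbreviation matrix_group :: "(real ^ 'n ^ 'n) set \<Rightarrow> (real ^ 'n ^ 'n) monoid" where
  "matrix_group Q \<equiv> GL\<lparr>carrier := Q\<rparr>"

definition closed_matrix_group :: "(real ^ 'n ^ 'n) set \<Rightarrow> bool" where
  "closed_matrix_group Q \<longleftrightarrow>
     subgroup Q GL \<and> closedin (top_of_set (carrier GL)) Q"

text \<open>The group operations are restrictions of smooth maps, so an embedded subgroup is a Lie group.
  For closed \<open>Q\<close>, being an embedded submanifold of \<open>Q\<close> or of the space of all matrices is the same.\<close>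

definition lie_subgroup :: "(real ^ 'n ^ 'n) set \<Rightarrow> (real ^ 'n ^ 'n) set \<Rightarrow> bool" where
  "lie_subgroup H Q \<longleftrightarrow> subgroup H (matrix_group Q) \<and> embedded_submanifold H"

primrec matrix_pow :: "real ^ 'n ^ 'n \<Rightarrow> nat \<Rightarrow> real ^ 'n ^ 'n" where
  "matrix_pow X 0 = mat 1"
| "matrix_pow X (Suc k) = X ** matrix_pow X k"

definition matrix_exp :: "real ^ 'n ^ 'n \<Rightarrow> real ^ 'n ^ 'n" where
  "matrix_exp X = (\<Sum>k. (1 / fact k) *\<^sub>R matrix_pow X k)"

definition lie_algebra :: "(real ^ 'n ^ 'n) set \<Rightarrow> (real ^ 'n ^ 'n) set" where
  "lie_algebra A = {X. \<forall>t::real. matrix_exp (t *\<^sub>R X) \<in> A}"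

definition additive_group :: "'a::ab_group_add set \<Rightarrow> 'a monoid" where
  "additive_group S = \<lparr>carrier = S, mult = (+), one = 0\<rparr>"

definition normalizes :: "(real ^ 'n ^ 'n) set \<Rightarrow> (real ^ 'n ^ 'n) set \<Rightarrow> bool" where
  "normalizes H N \<longleftrightarrow> (\<forall>h\<in>H. (\<lambda>\<nu>. h ** \<nu> ** matrix_inv h) ` N = N)"

definition exp_lattice :: "nat \<Rightarrow> (nat \<Rightarrow> real ^ 'n ^ 'n) \<Rightarrow> (real ^ 'n ^ 'n) set" where
  "exp_lattice r H = {matrix_exp (\<Sum>j=1..r. of_int (m j) *\<^sub>R H j) | m :: nat \<Rightarrow> int. True}"

definition dual_action :: "real ^ 'n ^ 'n \<Rightarrow> real ^ 'n \<Rightarrow> real ^ 'n" where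
  "dual_action q v = transpose (matrix_inv q) *v v"


section \<open>Separated sets\<close>

text \<open>\<open>G\<close> acts on the space \<open>X\<close> by \<open>\<phi>\<close>. Compactness and interior are those of \<open>X\<close>.\<close>

definition separated_by ::
  "('g, 'm) monoid_scheme \<Rightarrow> ('g \<Rightarrow> 'x \<Rightarrow> 'x) \<Rightarrow> 'x topology \<Rightarrow> 'g set \<Rightarrow> 'x set \<Rightarrow> bool" where
  "separated_by G \<phi> X \<Gamma> B \<longleftrightarrow>
     \<Gamma> \<subseteq> carrier G \<and> compactin X B \<and> X interior_of B \<noteq> {} \<and>
     (\<forall>h\<in>\<Gamma>. \<forall>k\<in>\<Gamma>. h \<noteq> k \<longrightarrow> \<phi> h ` B \<inter> \<phi> k ` B = {})"

definition separated ::
  "('g, 'm) monoid_scheme \<Rightarrow> ('g \<Rightarrow> 'x \<Rightarrow> 'x) \<Rightarrow> 'x topology \<Rightarrow> 'g set \<Rightarrow> bool" where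
  "separated G \<phi> X \<Gamma> \<longleftrightarrow> (\<exists>B. separated_by G \<phi> X \<Gamma> B)"

end

theory Submission
  imports Defs
begin

text \<open>Let \<open>F\<^sub>A\<close> and \<open>F\<^sub>N\<close> be small compact neighbourhoods of the identity in \<open>A\<close> and \<open>N\<close>, and put
  \<open>B = (F\<^sub>A F\<^sub>N R) \<cdot> \<omega>\<close>. If \<open>\<gamma> \<eta> B\<close> meets \<open>\<gamma>' \<eta>' B\<close>, then \<open>\<gamma> \<eta> a \<nu> \<rho>\<close> and
  \<open>\<gamma>' \<eta>' a' \<nu>' \<rho>'\<close> agree up to a right factor from the stabilizer, hence from \<open>R\<close>. Moving \<open>a\<close> past \<open>\<eta>\<close>
  and comparing the \<open>A\<close>-parts gives \<open>\<gamma>'\<^sup>-\<^sup>1 \<gamma> = a' a\<^sup>-\<^sup>1\<close>, which is near the identity, so \<open>\<gamma> = \<gamma>'\<close> and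
  \<open>a = a'\<close>; comparing the \<open>N\<close>-parts gives \<open>\<eta>'\<^sup>-\<^sup>1 \<eta> = a \<nu>' \<nu>\<^sup>-\<^sup>1 a\<^sup>-\<^sup>1\<close>, again near the identity, so
  \<open>\<eta> = \<eta>'\<close>. Two open mapping arguments based on Baire's theorem complete the proof: the exponential
  map of \<open>A\<close> is open at \<open>0\<close>, so that the image of the lattice is discrete, and the orbit map is open,
  so that \<open>B\<close> has interior points.\<close>

section \<open>Matrices\<close>

lemma
  fixes A :: "real ^ 'n ^ 'n"
  assumes "invertible A"
  shows matrix_inv_right: "A ** matrix_inv A = mat 1"
    and matrix_inv_left: "matrix_inv A ** A = mat 1"
  using someI_ex[OF assms[unfolded invertible_def]] by (auto simp: matrix_inv_def)

lemma invertible_matrix_inv: "invertible A \<Longrightarrow> invertible (matrix_inv A)"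
  for A :: "real ^ 'n ^ 'n"
  using matrix_inv_left matrix_inv_right invertible_def by blast

lemma
  fixes A B :: "real ^ 'n ^ 'n"
  assumes "invertible A"
  shows matrix_inv_cancel_left: "matrix_inv A ** (A ** B) = B"
    and matrix_inv_cancel_right: "A ** (matrix_inv A ** B) = B"
  using assms by (simp_all add: matrix_mul_assoc matrix_inv_left matrix_inv_right)

lemma matrix_inv_unique:
  fixes A B :: "real ^ 'n ^ 'n"
  assumes "invertible A" "A ** B = mat 1"
  shows "matrix_inv A = B"
  using assms matrix_inv_cancel_left[of A B] by simp

lemma matrix_inv_mult:
  fixes A B :: "real ^ 'n ^ 'n"
  assumes "invertible A" "invertible B"
  shows "matrix_inv (A ** B) = matrix_inv B ** matrix_inv A"
  using assms
  by (intro matrix_inv_unique)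
    (simp_all add: invertible_mult matrix_inv_cancel_right matrix_inv_right flip: matrix_mul_assoc)

lemma matrix_inv_mat_1: "matrix_inv (mat 1 :: real ^ 'n ^ 'n) = mat 1"
  by (rule matrix_inv_unique) (auto simp: invertible_def)

lemma matrix_inv_matrix_inv: "invertible A \<Longrightarrow> matrix_inv (matrix_inv A) = A"
  for A :: "real ^ 'n ^ 'n"
  by (simp add: matrix_inv_unique invertible_matrix_inv matrix_inv_left)

section \<open>Continuity of the matrix operations\<close>

lemma continuous_on_matrix_mult [continuous_intros]:
  fixes f :: "'a::topological_space \<Rightarrow> real ^ 'n ^ 'm" and g :: "'a \<Rightarrow> real ^ 'k ^ 'n"
  assumes "continuous_on S f" "continuous_on S g"
  shows "continuous_on S (\<lambda>x. f x ** g x)"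
  unfolding matrix_matrix_mult_def
  by (intro continuous_on_vec_lambda continuous_intros assms)

lemma continuous_on_matrix_vector_mult' [continuous_intros]:
  fixes f :: "'a::topological_space \<Rightarrow> real ^ 'n ^ 'm" and g :: "'a \<Rightarrow> real ^ 'n"
  assumes "continuous_on S f" "continuous_on S g"
  shows "continuous_on S (\<lambda>x. f x *v g x)"
  unfolding matrix_vector_mult_def
  by (intro continuous_on_vec_lambda continuous_intros assms)

lemma continuous_on_transpose [continuous_intros]:
  fixes f :: "'a::topological_space \<Rightarrow> real ^ 'n ^ 'm"
  assumes "continuous_on S f"
  shows "continuous_on S (\<lambda>x. transpose (f x))"
  unfolding transpose_def
  by (intro continuous_on_vec_lambda continuous_intros assms)

lemma continuous_on_det [continuous_intros]:
  fixes f :: "'a::topological_space \<Rightarrow> real ^ 'n ^ 'n"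
  assumes "continuous_on S f"
  shows "continuous_on S (\<lambda>x. det (f x))"
  unfolding det_def by (intro continuous_intros assms)

text \<open>Cramer's rule for column \<open>j\<close> of the inverse. It displays the entries as
  quotients of determinants, from which continuity of inversion follows.\<close>

lemma matrix_inv_entry:
  fixes A :: "real ^ 'n ^ 'n"
  assumes "invertible A"
  shows "matrix_inv A $ i $ j = det (\<chi> k l. if l = i then axis j 1 $ k else A $ k $ l) / det A"
proof -
  have "A *v (matrix_inv A *v axis j 1) = axis j 1"
    using assms by (simp add: matrix_vector_mul_assoc matrix_inv_right)
  then have "(matrix_inv A *v axis j 1) $ i = det (\<chi> k l. if l = i then axis j 1 $ k else A $ k $ l) / det A"
    using cramer[of A] assms by (simp add: invertible_det_nz)
  moreover have "(matrix_inv A *v axis j 1) $ i = matrix_inv A $ i $ j"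
    by (simp add: matrix_vector_mul_component inner_axis)
  ultimately show ?thesis
    by simp
qed

lemma continuous_on_matrix_inv [continuous_intros]:
  fixes f :: "'a::topological_space \<Rightarrow> real ^ 'n ^ 'n"
  assumes "continuous_on S f" "\<And>x. x \<in> S \<Longrightarrow> invertible (f x)"
  shows "continuous_on S (\<lambda>x. matrix_inv (f x))"
proof -
  \<comment> \<open>The condition does not depend on \<open>x\<close>, so the case split leaves a
    constant or an entry of \<open>f x\<close>.\<close>
  have "continuous_on S (\<lambda>x. if l = i then c else f x $ k $ l)" for i l k and c :: real
    by (cases "l = i") (auto intro!: continuous_intros assms(1))
  then have "continuous_on S (\<lambda>x. \<chi> i j. det (\<chi> k l. if l = i then axis j 1 $ k else f x $ k $ l) / det (f x))"
    by (intro continuous_on_vec_lambda continuous_intros assms(1))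
      (use assms(2) in \<open>auto simp: invertible_det_nz\<close>)
  then show ?thesis
    by (rule continuous_on_eq) (simp add: vec_eq_iff matrix_inv_entry assms(2))
qed

lemma open_invertible_matrices: "open {g :: real ^ 'n ^ 'n. invertible g}"
proof -
  have "{g :: real ^ 'n ^ 'n. invertible g} = det -` (- {0})"
    by (auto simp: invertible_det_nz)
  then show ?thesis
    by (simp only:) (intro open_vimage continuous_intros open_Compl closed_singleton)
qed

section \<open>Norm bounds and continuity of the exponential series\<close>

lemma matrix_add_rdistrib: "(A + B) ** C = A ** C + B ** C"
  for A B :: "real ^ 'n ^ 'm"
  by (simp add: vec_eq_iff matrix_matrix_mult_def sum.distrib distrib_right)

text \<open>The norm is the Euclidean norm of the entries; bilinear maps in finite dimension are
  bounded, which is enough to dominate the exponential series.\<close>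

lemma matrix_mult_norm_bound:
  obtains K where "K > 0" "\<And>(x :: real ^ 'n ^ 'n) (y :: real ^ 'n ^ 'n). norm (x ** y) \<le> norm x * norm y * K"
proof -
  have "bilinear (\<lambda>(x :: real ^ 'n ^ 'n) (y :: real ^ 'n ^ 'n). x ** y)"
    by (auto simp: bilinear_def intro!: linearI
        simp: matrix_add_ldistrib matrix_add_rdistrib matrix_scalar_ac scalar_matrix_assoc[symmetric])
  then show thesis
    using that bounded_bilinear.pos_bounded[of "\<lambda>(x :: real ^ 'n ^ 'n) (y :: real ^ 'n ^ 'n). x ** y"]
    by (auto simp: bilinear_conv_bounded_bilinear)
qed

lemma continuous_on_matrix_exp: "continuous_on S (matrix_exp :: real ^ 'n ^ 'n \<Rightarrow> _)"
proof -
  obtain K where K: "K > 0" "\<And>(x :: real ^ 'n ^ 'n) (y :: real ^ 'n ^ 'n). norm (x ** y) \<le> norm x * norm y * K"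
    by (rule matrix_mult_norm_bound) blast
  let ?I = "mat 1 :: real ^ 'n ^ 'n"
  \<comment> \<open>The factor \<open>norm ?I\<close> comes from the zeroth power: the Euclidean
    norm of the identity matrix need not be 1.\<close>
  have pow_le: "norm (matrix_pow X k) \<le> norm ?I * (norm X * K) ^ k" for X :: "real ^ 'n ^ 'n" and k
  proof (induction k)
    case (Suc k)
    have "norm (X ** matrix_pow X k) \<le> norm X * norm (matrix_pow X k) * K"
      by (rule K(2))
    also have "\<dots> \<le> norm X * (norm ?I * (norm X * K) ^ k) * K"
      using Suc K(1) by (intro mult_right_mono mult_left_mono) auto
    finally show ?case
      by (simp add: algebra_simps)
  qed simp
  have cont_pow: "continuous_on T (\<lambda>X :: real ^ 'n ^ 'n. matrix_pow X k)" for k T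
    by (induction k) (auto intro!: continuous_intros)
  \<comment> \<open>The majorant depends on a bound for \<open>norm X\<close>, so the M-test is
    applied on balls; continuity is local and these balls exhaust the space.\<close>
  have "continuous_on (ball 0 b) (matrix_exp :: real ^ 'n ^ 'n \<Rightarrow> _)" for b :: real
  proof (cases "b > 0")
    case True
    have "norm ((1 / fact k) *\<^sub>R matrix_pow X k) \<le> norm ?I * ((b * K) ^ k /\<^sub>R fact k)"
      if "X \<in> ball 0 b" for X :: "real ^ 'n ^ 'n" and k
    proof -
      have "norm ?I * (norm X * K) ^ k \<le> norm ?I * (b * K) ^ k"
        using that K(1) by (intro mult_left_mono power_mono mult_right_mono) auto
      then have "norm (matrix_pow X k) \<le> norm ?I * (b * K) ^ k"
        by (rule order_trans[OF pow_le])
      then have "(1 / fact k) * norm (matrix_pow X k) \<le> (1 / fact k) * (norm ?I * (b * K) ^ k)"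
        by (intro mult_left_mono) auto
      then show ?thesis
        by (simp add: inverse_eq_divide mult.left_commute)
    qed
    moreover have "summable (\<lambda>k. norm ?I * ((b * K) ^ k /\<^sub>R fact k))"
      by (intro summable_mult summable_exp_generic)
    ultimately have "uniform_limit (ball 0 b) (\<lambda>n (X :: real ^ 'n ^ 'n). \<Sum>k<n. (1 / fact k) *\<^sub>R matrix_pow X k)
        (\<lambda>X. \<Sum>k. (1 / fact k) *\<^sub>R matrix_pow X k) sequentially"
      by (rule Weierstrass_m_test)
    then show ?thesis
      unfolding matrix_exp_def
      by (rule uniform_limit_theorem[rotated]) (intro always_eventually allI continuous_intros cont_pow | simp)+
  qed (simp add: ball_empty)
  then have "isCont matrix_exp X" for X :: "real ^ 'n ^ 'n"
    using continuous_on_interior[of "ball 0 (norm X + 1)" matrix_exp X] by simp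
  then show ?thesis
    by (simp add: continuous_at_imp_continuous_on)
qed

section \<open>The group GL, Baire's theorem and the dual action\<close>

lemma invertible_mat_1: "invertible (mat 1 :: real ^ 'n ^ 'n)"
  by (auto simp: invertible_def)

lemma group_GL: "group (GL :: (real ^ 'n ^ 'n) monoid)"
proof (rule groupI)
  fix x :: "real ^ 'n ^ 'n"
  assume "x \<in> carrier GL"
  then show "\<exists>y\<in>carrier GL. y \<otimes>\<^bsub>GL\<^esub> x = \<one>\<^bsub>GL\<^esub>"
    by (intro bexI[of _ "matrix_inv x"]) (simp_all add: GL_def matrix_inv_left invertible_matrix_inv)
qed (simp_all add: GL_def matrix_mul_assoc invertible_mult invertible_mat_1)

text \<open>If every member had empty interior in \<open>S\<close>, Baire's theorem would give their
  union empty interior, but the union is the nonempty space \<open>S\<close> itself.\<close>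

lemma baire_interior_nonempty:
  assumes "completely_metrizable_space (top_of_set S)" "S \<noteq> {}" "countable \<G>" "S \<subseteq> \<Union>\<G>"
    and "\<And>T. T \<in> \<G> \<Longrightarrow> closedin (top_of_set S) T"
  shows "\<exists>T\<in>\<G>. \<exists>W. openin (top_of_set S) W \<and> W \<noteq> {} \<and> W \<subseteq> T"
proof (rule ccontr)
  assume neg: "\<not> ?thesis"
  have "top_of_set S interior_of T = {}" if "T \<in> \<G>" for T
    using neg that openin_interior_of[of "top_of_set S" T] interior_of_subset[of "top_of_set S" T] by blast
  then have "top_of_set S interior_of \<Union>\<G> = {}"
    using assms by (intro Baire_category_alt) simp_all
  moreover have "\<Union>\<G> = S"
    using assms(4,5) closedin_imp_subset by blast
  ultimately show False
    using assms(2) interior_of_topspace[of "top_of_set S"] by simp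
qed

lemma subgroup_GLD:
  fixes S :: "(real ^ 'n ^ 'n) set"
  assumes "subgroup S GL"
  shows "g \<in> S \<Longrightarrow> invertible g" "mat 1 \<in> S"
    "g \<in> S \<Longrightarrow> h \<in> S \<Longrightarrow> g ** h \<in> S" "g \<in> S \<Longrightarrow> matrix_inv g \<in> S"
proof -
  show inv: "invertible g" if "g \<in> S" for g
    using subgroup.subset[OF assms] that by (auto simp: GL_def)
  show "mat 1 \<in> S"
    using subgroup.one_closed[OF assms] by (simp add: GL_def)
  show "g ** h \<in> S" if "g \<in> S" "h \<in> S" for g h
    using subgroup.m_closed[OF assms that] by (simp add: GL_def)
  show "matrix_inv g \<in> S" if "g \<in> S" for g
  proof -
    have "inv\<^bsub>GL\<^esub> g = matrix_inv g"
      using inv[OF that]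
      by (intro group.inv_equality[OF group_GL]) (simp_all add: GL_def matrix_inv_left invertible_matrix_inv)
    then show ?thesis
      using subgroup.m_inv_closed[OF assms that] by simp
  qed
qed

text \<open>Inversion and transposition both reverse products, so together they preserve the
  order.\<close>

lemma dual_action_mult:
  fixes g h :: "real ^ 'n ^ 'n"
  assumes "invertible g" "invertible h"
  shows "dual_action (g ** h) v = dual_action g (dual_action h v)"
  using assms by (simp add: dual_action_def matrix_inv_mult matrix_transpose_mul matrix_vector_mul_assoc
      del: transpose_matrix_vector)

lemma dual_action_mat_1: "dual_action (mat 1) v = v"
  by (simp add: dual_action_def matrix_inv_mat_1)

lemma dual_action_inv_cancel:
  fixes g :: "real ^ 'n ^ 'n"
  assumes "invertible g"
  shows "dual_action (matrix_inv g) (dual_action g v) = v"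
  using assms
  by (simp add: dual_action_mat_1 matrix_inv_left invertible_matrix_inv flip: dual_action_mult)

lemma continuous_on_dual_action [continuous_intros]:
  fixes f :: "'a::topological_space \<Rightarrow> real ^ 'n ^ 'n" and g :: "'a \<Rightarrow> real ^ 'n"
  assumes "continuous_on S f" "continuous_on S g" "\<And>x. x \<in> S \<Longrightarrow> invertible (f x)"
  shows "continuous_on S (\<lambda>x. dual_action (f x) (g x))"
  unfolding dual_action_def by (intro continuous_intros assms)

text \<open>Supplies the countable sets of translates for the two Baire arguments.\<close>

lemma separable_dense_meets_openin:
  fixes S :: "'a::{metric_space, second_countable_topology} set"
  obtains T where "countable T" "T \<subseteq> S" "\<And>W. openin (top_of_set S) W \<Longrightarrow> W \<noteq> {} \<Longrightarrow> T \<inter> W \<noteq> {}"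
proof -
  obtain T where T: "countable T" "T \<subseteq> S" "S \<subseteq> closure T"
    by (rule separable)
  show thesis
  proof (rule that[OF T(1,2)])
    fix W
    assume W: "openin (top_of_set S) W" "W \<noteq> {}"
    then obtain U where U: "open U" "W = S \<inter> U"
      by (auto simp: openin_open)
    then have "U \<inter> closure T \<noteq> {}"
      using W T by blast
    then have "U \<inter> T \<noteq> {}"
      using open_Int_closure_eq_empty[OF U(1)] by blast
    then show "T \<inter> W \<noteq> {}"
      using U T(2) by blast
  qed
qed

text \<open>Subgroups will be closed only relative to GL. Inside a closed ball contained in
  \<open>X\<close>, relative closedness amounts to closedness.\<close>

lemma compact_closedin_Int_cball:
  fixes S :: "'a::heine_borel set"
  assumes "closedin (top_of_set X) S" "cball x e \<subseteq> X"
  shows "compact (S \<inter> cball x e)"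
proof -
  obtain T where "closed T" "S = X \<inter> T"
    using assms(1) by (auto simp: closedin_closed)
  then have "S \<inter> cball x e = T \<inter> cball x e"
    using assms(2) by blast
  then show ?thesis
    using \<open>closed T\<close> by (simp add: closed_Int_compact)
qed

text \<open>Each coordinate functional extends to a linear, hence bounded, functional on the whole
  space. A short integer combination therefore has coordinates of absolute value below 1, and such
  integers vanish.\<close>

lemma integer_combinations_discrete:
  fixes H :: "'i \<Rightarrow> 'a::euclidean_space"
  assumes "finite I" "inj_on H I" "independent (H ` I)"
  obtains \<delta> :: real where "\<delta> > 0"
    "\<And>m :: 'i \<Rightarrow> int. norm (\<Sum>j\<in>I. of_int (m j) *\<^sub>R H j) < \<delta> \<Longrightarrow> (\<Sum>j\<in>I. of_int (m j) *\<^sub>R H j) = 0"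
proof -
  have "\<exists>K>0. \<forall>m :: 'i \<Rightarrow> int. \<bar>of_int (m j)\<bar> \<le> norm (\<Sum>j\<in>I. of_int (m j) *\<^sub>R H j) * K"
    if "j \<in> I" for j
  proof -
    obtain g :: "'a \<Rightarrow> real" where g: "linear g" "\<forall>b\<in>H ` I. g b = (if b = H j then 1 else 0)"
      using linear_independent_extend[OF assms(3), of "\<lambda>b. if b = H j then 1 else (0::real)"] by blast
    have "g (\<Sum>i\<in>I. of_int (m i) *\<^sub>R H i) = of_int (m j)" for m :: "'i \<Rightarrow> int"
    proof -
      have "g (\<Sum>i\<in>I. of_int (m i) *\<^sub>R H i) = (\<Sum>i\<in>I. of_int (m i) * g (H i))"
        using g(1) by (simp add: linear_sum linear_scale)
      also have "\<dots> = (\<Sum>i\<in>I. if i = j then of_int (m i) else 0)"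
        using g(2) that assms(2) by (intro sum.cong) (auto dest: inj_onD)
      finally show ?thesis
        using assms(1) that by simp
    qed
    moreover obtain K where "K > 0" "\<And>v. norm (g v) \<le> norm v * K"
      using bounded_linear.pos_bounded[of g] g(1) by (auto simp: linear_conv_bounded_linear)
    ultimately show ?thesis
      by (metis real_norm_def)
  qed
  then obtain K where K: "\<And>j. j \<in> I \<Longrightarrow> K j > 0"
    "\<And>j m. j \<in> I \<Longrightarrow> \<bar>of_int (m j :: int)\<bar> \<le> norm (\<Sum>j\<in>I. of_int (m j) *\<^sub>R H j) * K j"
    by metis
  have sum_nonneg: "(\<Sum>j\<in>I. K j) \<ge> 0"
    using K(1) by (intro sum_nonneg) (auto intro: less_imp_le)
  show thesis
  proof
    \<comment> \<open>The sum dominates every single bound \<open>K j\<close>; adding 1 keeps the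
      denominator positive when \<open>I\<close> is empty.\<close>
    show "1 / ((\<Sum>j\<in>I. K j) + 1) > 0"
      using sum_nonneg by simp
    fix m :: "'i \<Rightarrow> int"
    assume small: "norm (\<Sum>j\<in>I. of_int (m j) *\<^sub>R H j) < 1 / ((\<Sum>j\<in>I. K j) + 1)" (is "?n < _")
    have "m j = 0" if "j \<in> I" for j
    proof -
      have "K j \<le> (\<Sum>j\<in>I. K j)"
        using assms(1) that K(1) by (intro member_le_sum) (auto intro: less_imp_le)
      then have "?n * K j \<le> ?n * ((\<Sum>j\<in>I. K j) + 1)"
        by (intro mult_left_mono) auto
      also have "\<dots> < 1"
        using small sum_nonneg by (simp add: pos_less_divide_eq)
      finally have "\<bar>real_of_int (m j)\<bar> < 1"
        using K(2)[OF that, of m] by simp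
      then show ?thesis
        by linarith
    qed
    then show "(\<Sum>j\<in>I. of_int (m j) *\<^sub>R H j) = 0"
      by simp
  qed
qed

section \<open>Openness of the exponential and orbit maps\<close>

text \<open>The isomorphism in the theorem is algebraic and gives by itself no control over
  logarithms. Baire's theorem on \<open>A\<close> supplies short logarithms near the
  identity.\<close>

lemma matrix_exp_open_at_0:
  fixes A V :: "(real ^ 'n ^ 'n) set"
  assumes A: "subgroup A GL" "closedin (top_of_set (carrier GL)) A"
    and V: "subspace V" "matrix_exp ` V = A"
    and hom: "\<And>X Y. X \<in> V \<Longrightarrow> Y \<in> V \<Longrightarrow> matrix_exp (X + Y) = matrix_exp X ** matrix_exp Y"
    and "\<delta> > 0"
  obtains U where "open U" "mat 1 \<in> U" "A \<inter> U \<subseteq> matrix_exp ` (V \<inter> ball 0 \<delta>)"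
proof -
  note A' = subgroup_GLD[OF A(1)]
  \<comment> \<open>Differences of two elements of \<open>D\<close> have norm at most two thirds of
    \<delta>, hence below \<delta>.\<close>
  define D where "D = V \<inter> cball 0 (\<delta> / 3)"
  have D: "compact D"
    unfolding D_def using V(1) by (simp add: closed_Int_compact closed_subspace)
  obtain T where T: "countable T" "T \<subseteq> V"
    "\<And>W. openin (top_of_set V) W \<Longrightarrow> W \<noteq> {} \<Longrightarrow> T \<inter> W \<noteq> {}"
    using separable_dense_meets_openin[of V] by blast
  txt \<open>Countably many translates of the compact set \<open>exp D\<close> cover \<open>A\<close>, so one has interior points;
    quotients of its elements lie in \<open>exp (D - D)\<close>.\<close>
  let ?\<G> = "(\<lambda>s. (\<lambda>X. matrix_exp (s + X)) ` D) ` T"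
  \<comment> \<open>GL is open in the space of all matrices and \<open>A\<close> is closed in GL;
    both passages preserve complete metrizability.\<close>
  have cm: "completely_metrizable_space (top_of_set A)"
    using completely_metrizable_space_closedin[OF _ A(2)]
      completely_metrizable_space_openin[OF completely_metrizable_space_euclidean, of "carrier GL :: (real ^ 'n ^ 'n) set"]
      closedin_imp_subset[OF A(2)] open_invertible_matrices[where 'n = 'n]
    by (simp add: GL_def subtopology_subtopology Int_absorb1)
  have cov: "A \<subseteq> \<Union>?\<G>"
  proof
    fix a
    assume "a \<in> A"
    then obtain X where X: "X \<in> V" "a = matrix_exp X"
      using V(2) by blast
    have "openin (top_of_set V) (V \<inter> ball X (\<delta> / 3))" "V \<inter> ball X (\<delta> / 3) \<noteq> {}"
      using X \<open>\<delta> > 0\<close> by (auto simp: openin_open)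
    then obtain s where s: "s \<in> T" "s \<in> ball X (\<delta> / 3)"
      using T(3)[of "V \<inter> ball X (\<delta> / 3)"] by blast
    then have "X - s \<in> D"
      using X T(2) V(1) by (auto simp: D_def subspace_diff dist_norm norm_minus_commute)
    then show "a \<in> \<Union>?\<G>"
      using s X by (auto intro!: bexI[of _ s] image_eqI[of _ _ "X - s"])
  qed
  have clo: "closedin (top_of_set A) G" if "G \<in> ?\<G>" for G
  proof -
    obtain s where s: "s \<in> T" "G = (\<lambda>X. matrix_exp (s + X)) ` D"
      using \<open>G \<in> _\<close> by blast
    have "continuous_on D (\<lambda>X. matrix_exp (s + X))"
      by (rule continuous_on_compose2[OF continuous_on_matrix_exp[of UNIV]]) (auto intro: continuous_intros)
    then have "compact G"
      using D s by (simp add: compact_continuous_image)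
    moreover have "G \<subseteq> A"
      using s T(2) V by (auto simp: D_def intro!: subspace_add)
    ultimately show ?thesis
      by (simp add: closed_subset compact_imp_closed)
  qed
  have "A \<noteq> {}"
    using A'(2) by blast
  then have "\<exists>G\<in>?\<G>. \<exists>W. openin (top_of_set A) W \<and> W \<noteq> {} \<and> W \<subseteq> G"
    by (rule baire_interior_nonempty[OF cm _ countable_image[OF T(1)] cov clo])
  then obtain s W w where W: "s \<in> T" "openin (top_of_set A) W" "w \<in> W" "W \<subseteq> (\<lambda>X. matrix_exp (s + X)) ` D"
    by blast
  have wA: "w \<in> A"
    using W(2,3) openin_imp_subset by blast
  \<comment> \<open>Pulling \<open>W\<close> back along left multiplication by \<open>w\<close>
    gives a neighbourhood of \<open>mat 1\<close>.\<close>
  have "openin (top_of_set A) (A \<inter> (\<lambda>a. w ** a) -` W)"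
    using W(2) wA A'(3) by (intro continuous_openin_preimage continuous_intros) auto
  then obtain U where U: "open U" "A \<inter> (\<lambda>a. w ** a) -` W = A \<inter> U"
    by (auto simp: openin_open)
  show thesis
  proof (rule that[OF U(1)])
    show "mat 1 \<in> U"
      using U(2) A'(2) W(3) by auto
    show "A \<inter> U \<subseteq> matrix_exp ` (V \<inter> ball 0 \<delta>)"
    proof
      fix a
      assume "a \<in> A \<inter> U"
      then have "w ** a \<in> W"
        using U(2) by blast
      then obtain X Y where XY: "X \<in> D" "Y \<in> D" "w = matrix_exp (s + X)" "w ** a = matrix_exp (s + Y)"
        using W(3,4) by blast
      have mem: "s + X \<in> V" "Y - X \<in> V"
        using XY W(1) T(2) V(1) by (auto simp: D_def subspace_add subspace_diff)
      \<comment> \<open>Both \<open>w\<close> and \<open>w ** a\<close> lie in the same translate,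
        so the centre \<open>s\<close> cancels in their quotient.\<close>
      have "matrix_exp (s + Y) = matrix_exp ((s + X) + (Y - X))"
        by simp
      also have "\<dots> = w ** matrix_exp (Y - X)"
        using mem XY(3) by (simp only: hom)
      finally have "a = matrix_exp (Y - X)"
        using XY(4) matrix_inv_cancel_left[OF A'(1)[OF wA]] by metis
      moreover have "norm (Y - X) < \<delta>"
        using norm_triangle_ineq4[of Y X] XY(1,2) \<open>\<delta> > 0\<close> by (simp add: D_def)
      ultimately show "a \<in> matrix_exp ` (V \<inter> ball 0 \<delta>)"
        using mem by auto
    qed
  qed
qed

text \<open>A quotient near \<open>mat 1\<close> has one logarithm in the lattice and another of
  norm below \<delta>. By injectivity they coincide, and \<delta> is chosen so that only 0
  remains.\<close>

lemma exp_lattice_discrete: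
  fixes A :: "(real ^ 'n ^ 'n) set"
  assumes A: "subgroup A GL" "closedin (top_of_set (carrier GL)) A"
    and iso: "matrix_exp \<in> iso (additive_group (lie_algebra A)) (matrix_group A)"
    and H: "inj_on H {1..r}" "independent (H ` {1..r})" "span (H ` {1..r}) = lie_algebra A"
  shows "exp_lattice r H \<subseteq> A"
    and "\<exists>U. open U \<and> mat 1 \<in> U \<and>
      (\<forall>\<gamma>\<in>exp_lattice r H. \<forall>\<gamma>'\<in>exp_lattice r H. matrix_inv \<gamma>' ** \<gamma> \<in> U \<longrightarrow> \<gamma> = \<gamma>')"
proof -
  note A' = subgroup_GLD[OF A(1)]
  let ?V = "lie_algebra A"
  let ?c = "\<lambda>m :: nat \<Rightarrow> int. \<Sum>j=1..r. of_int (m j) *\<^sub>R H j"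
  have bij: "bij_betw matrix_exp ?V A"
    and hom: "\<And>X Y. X \<in> ?V \<Longrightarrow> Y \<in> ?V \<Longrightarrow> matrix_exp (X + Y) = matrix_exp X ** matrix_exp Y"
    using iso by (auto simp: iso_def hom_def additive_group_def GL_def)
  \<comment> \<open>The Lie algebra is a subspace because it is the span of the given basis.\<close>
  have V: "subspace ?V" "matrix_exp ` ?V = A"
    using H(3) subspace_span[of "H ` {1..r}"] bij by (auto simp: bij_betw_def)
  have cV: "?c m \<in> ?V" for m
    unfolding H(3)[symmetric] by (intro span_sum span_scale span_base) auto
  show sub: "exp_lattice r H \<subseteq> A"
    using cV V(2) by (auto simp: exp_lattice_def)
  obtain \<delta> where \<delta>: "\<delta> > 0" "\<And>m. norm (?c m) < \<delta> \<Longrightarrow> ?c m = 0"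
    using integer_combinations_discrete[of "{1..r}" H] H by auto
  obtain U where U: "open U" "mat 1 \<in> U" "A \<inter> U \<subseteq> matrix_exp ` (?V \<inter> ball 0 \<delta>)"
    using matrix_exp_open_at_0[OF A V hom \<delta>(1)] by blast
  have "\<gamma> = \<gamma>'" if \<gamma>: "\<gamma> \<in> exp_lattice r H" "\<gamma>' \<in> exp_lattice r H" "matrix_inv \<gamma>' ** \<gamma> \<in> U" for \<gamma> \<gamma>'
  proof -
    obtain m m' where m: "\<gamma> = matrix_exp (?c m)" "\<gamma>' = matrix_exp (?c m')"
      using \<gamma>(1,2) by (auto simp: exp_lattice_def)
    have diff: "?c m - ?c m' = ?c (\<lambda>j. m j - m' j)"
      by (simp add: sum_subtractf scaleR_left_diff_distrib)
    have "\<gamma> = matrix_exp (?c m' + ?c (\<lambda>j. m j - m' j))"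
      unfolding m diff[symmetric] by simp
    also have "\<dots> = \<gamma>' ** matrix_exp (?c (\<lambda>j. m j - m' j))"
      unfolding m by (rule hom[OF cV cV])
    finally have eq: "matrix_inv \<gamma>' ** \<gamma> = matrix_exp (?c (\<lambda>j. m j - m' j))"
      using matrix_inv_cancel_left[OF A'(1)] \<gamma>(2) sub by auto
    have "matrix_inv \<gamma>' ** \<gamma> \<in> A"
      using \<gamma> sub A'(3,4) by blast
    then obtain Y where Y: "Y \<in> ?V" "norm Y < \<delta>" "matrix_inv \<gamma>' ** \<gamma> = matrix_exp Y"
      using U(3) \<gamma>(3) by auto
    have "?c (\<lambda>j. m j - m' j) = Y"
      by (rule inj_onD[OF bij_betw_imp_inj_on[OF bij] _ cV Y(1)]) (use Y(3) eq in simp)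
    then have "?c m - ?c m' = 0"
      unfolding diff using \<delta>(2)[of "\<lambda>j. m j - m' j"] Y(2) by simp
    then show ?thesis
      by (simp add: m)
  qed
  then show "\<exists>U. open U \<and> mat 1 \<in> U \<and>
      (\<forall>\<gamma>\<in>exp_lattice r H. \<forall>\<gamma>'\<in>exp_lattice r H. matrix_inv \<gamma>' ** \<gamma> \<in> U \<longrightarrow> \<gamma> = \<gamma>')"
    using U by blast
qed

text \<open>The orbit is open in a Euclidean space, so Baire's theorem applies to it. The relatively
  open \<open>V\<close> inside \<open>C\<close> is what lets countably many translates of
  \<open>C\<close> cover \<open>Q\<close>.\<close>

lemma interior_orbit_image_nonempty:
  fixes Q :: "(real ^ 'n ^ 'n) set"
  assumes Q: "subgroup Q GL" and "open \<O>" "\<O> = (\<lambda>q. dual_action q \<omega>) ` Q"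
    and V: "openin (top_of_set Q) V" "V \<noteq> {}" "V \<subseteq> C" and C: "compact C" "C \<subseteq> Q"
  shows "interior ((\<lambda>q. dual_action q \<omega>) ` C) \<noteq> {}"
proof -
  note Q' = subgroup_GLD[OF Q]
  let ?B = "(\<lambda>q. dual_action q \<omega>) ` C"
  obtain v where v: "v \<in> V"
    using V(2) by blast
  have VQ: "V \<subseteq> Q"
    using V(3) C(2) by blast
  obtain T where T: "countable T" "T \<subseteq> Q"
    "\<And>W. openin (top_of_set Q) W \<Longrightarrow> W \<noteq> {} \<Longrightarrow> T \<inter> W \<noteq> {}"
    using separable_dense_meets_openin[of Q] by blast
  have contB: "continuous_on C (\<lambda>q. dual_action q \<omega>)"
    using C(2) Q'(1) by (intro continuous_intros) auto
  have cont: "continuous_on S (dual_action s)" if "s \<in> Q" for s S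
    using that Q'(1) by (intro continuous_intros) auto
  txt \<open>Countably many translates of the compact set \<open>C \<cdot> \<omega>\<close> cover the orbit.\<close>
  have cov: "\<O> \<subseteq> \<Union>((\<lambda>s. dual_action s ` ?B) ` T)"
  proof
    fix x
    assume "x \<in> \<O>"
    then obtain q where q: "q \<in> Q" "x = dual_action q \<omega>"
      using assms(3) by blast
    \<comment> \<open>These are the \<open>s\<close> whose translate of \<open>V\<close> contains
      \<open>q\<close>; the element \<open>q ** matrix_inv v\<close> is one, since it multiplies
      \<open>v\<close> to \<open>q\<close>.\<close>
    let ?W = "Q \<inter> (\<lambda>s. matrix_inv s ** q) -` V"
    have "openin (top_of_set Q) ?W"
      using V(1) q Q' by (intro continuous_openin_preimage continuous_intros) auto
    moreover have "q ** matrix_inv v \<in> ?W"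
      using q v VQ Q'
      by (auto simp: matrix_inv_mult invertible_matrix_inv matrix_inv_matrix_inv matrix_inv_left
          simp flip: matrix_mul_assoc)
    ultimately obtain s where s: "s \<in> T" "matrix_inv s ** q \<in> V"
      using T(3)[of ?W] by blast
    have inv: "invertible s" "invertible q"
      using s T(2) q Q'(1) by auto
    have "x = dual_action (s ** (matrix_inv s ** q)) \<omega>"
      using inv q by (simp add: matrix_inv_cancel_right)
    also have "\<dots> = dual_action s (dual_action (matrix_inv s ** q) \<omega>)"
      using inv by (intro dual_action_mult invertible_mult invertible_matrix_inv)
    finally show "x \<in> \<Union>((\<lambda>s. dual_action s ` ?B) ` T)"
      using s V(3) by blast
  qed
  have clo: "closedin (top_of_set \<O>) G" if "G \<in> (\<lambda>s. dual_action s ` ?B) ` T" for G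
  proof -
    obtain s where s: "s \<in> Q" "G = dual_action s ` ?B"
      using \<open>G \<in> _\<close> T(2) by blast
    have "compact G"
      using s C contB cont by (simp add: compact_continuous_image)
    moreover have "dual_action s (dual_action c \<omega>) \<in> \<O>" if "c \<in> C" for c
      using that s C(2) Q' by (auto simp: assms(3) subset_iff simp flip: dual_action_mult)
    ultimately show ?thesis
      using s by (auto intro!: closed_subset compact_imp_closed)
  qed
  have "completely_metrizable_space (top_of_set \<O>)"
    using assms(2) completely_metrizable_space_openin[OF completely_metrizable_space_euclidean, of \<O>] by simp
  moreover have "\<O> \<noteq> {}"
    using assms(3) Q'(2) by auto
  ultimately have "\<exists>G\<in>(\<lambda>s. dual_action s ` ?B) ` T. \<exists>W. openin (top_of_set \<O>) W \<and> W \<noteq> {} \<and> W \<subseteq> G"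
    by (rule baire_interior_nonempty[OF _ _ countable_image[OF T(1)] cov clo])
  then obtain s W w where W: "s \<in> T" "openin (top_of_set \<O>) W" "w \<in> W" "W \<subseteq> dual_action s ` ?B"
    by blast
  have sQ: "s \<in> Q"
    using W(1) T(2) by blast
  \<comment> \<open>Openness of the orbit makes \<open>W\<close> open in the whole space. Its
    preimage under \<open>dual_action s\<close> is then open, and injectivity of that map puts the
    preimage inside \<open>?B\<close>.\<close>
  have "open W"
    using W(2) assms(2) openin_open_eq by blast
  then have "open (dual_action s -` W)"
    using cont[OF sQ] by (simp add: open_vimage)
  moreover have "dual_action s -` W \<subseteq> ?B"
  proof
    fix x
    assume "x \<in> dual_action s -` W"
    then obtain b where "b \<in> ?B" "dual_action s x = dual_action s b"
      using W(4) by blast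
    then show "x \<in> ?B"
      using dual_action_inv_cancel[OF Q'(1)[OF sQ]] by metis
  qed
  moreover obtain b where "b \<in> dual_action s -` W"
    using W(3,4) by blast
  ultimately show ?thesis
    using interior_maximal by blast
qed

section \<open>Separation\<close>

lemma continuous_nbhd_cball:
  fixes x :: "'a::metric_space" and F :: "'a \<Rightarrow> 'b::topological_space"
  assumes "continuous_on S F" "open S" "x \<in> S" "open U" "F x \<in> U"
  obtains e where "e > 0" "cball x e \<subseteq> S" "\<And>y. y \<in> cball x e \<Longrightarrow> F y \<in> U"
proof -
  have "open (S \<inter> F -` U)" "x \<in> S \<inter> F -` U"
    using assms continuous_open_preimage by auto
  then obtain e where "e > 0" "cball x e \<subseteq> S \<inter> F -` U"
    using open_contains_cball by metis
  then show thesis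
    by (intro that[of e]) auto
qed

text \<open>The factors \<open>A\<close> and \<open>N\<close> are images of closed slices of the
  product, and a homeomorphism onto \<open>Q\<close> carries these to closed subsets of
  \<open>Q\<close>.\<close>

lemma homeomorphism_mult_closedin_factors:
  fixes Q A N R :: "(real ^ 'n ^ 'n) set"
  assumes "homeomorphism (A \<times> N \<times> R) Q (\<lambda>(a, \<nu>, \<rho>). a ** \<nu> ** \<rho>) g"
    and "closedin (top_of_set X) Q" "mat 1 \<in> A" "mat 1 \<in> N" "mat 1 \<in> R"
  shows "closedin (top_of_set X) A" "closedin (top_of_set X) N"
proof -
  let ?f = "\<lambda>(a, \<nu>, \<rho>). a ** \<nu> ** \<rho> :: real ^ 'n ^ 'n"
  have clo: "closedin (top_of_set X) (?f ` S)" if "closedin (top_of_set (A \<times> N \<times> R)) S" for S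
    using homeomorphism_imp_closed_map[OF assms(1) that] assms(2) closedin_trans by blast
  have "closedin (top_of_set (A \<times> N \<times> R)) (A \<times> {mat 1} \<times> {mat 1})"
    using assms by (intro closedin_Times closedin_subtopology_refl[THEN iffD2]) auto
  moreover have "?f ` (A \<times> {mat 1} \<times> {mat 1}) = A"
    by force
  ultimately show "closedin (top_of_set X) A"
    using clo by metis
  have "closedin (top_of_set (A \<times> N \<times> R)) ({mat 1} \<times> N \<times> {mat 1})"
    using assms by (intro closedin_Times closedin_subtopology_refl[THEN iffD2]) auto
  moreover have "?f ` ({mat 1} \<times> N \<times> {mat 1}) = N"
    by force
  ultimately show "closedin (top_of_set X) N"
    using clo by metis
qed

theorem theorem4p1:
  fixes Q A N R \<Gamma>\<^sub>N :: "(real ^ 'n ^ 'n) set"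
    and H :: "nat \<Rightarrow> real ^ 'n ^ 'n" and r :: nat
    and \<O> :: "(real ^ 'n) set" and \<omega> :: "real ^ 'n"
  assumes "closed_matrix_group Q"
    and "lie_subgroup A Q" and "lie_subgroup N Q" and "lie_subgroup R Q"
    and "Q = {a ** \<nu> ** \<rho> | a \<nu> \<rho>. a \<in> A \<and> \<nu> \<in> N \<and> \<rho> \<in> R}"
    and "diffeomorphism (A \<times> N \<times> R) Q (\<lambda>(a, \<nu>, \<rho>). a ** \<nu> ** \<rho>)"
    and "compact R"
    and "\<forall>a\<in>A. \<forall>b\<in>A. a ** b = b ** a"
    and "\<forall>a\<in>A. \<forall>\<rho>\<in>R. a ** \<rho> = \<rho> ** a"
    and "normalizes R N" and "normalizes A N"
    and "matrix_exp \<in> iso (additive_group (lie_algebra A)) (matrix_group A)"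
    and "inj_on H {1..r}" and "independent (H ` {1..r})" and "span (H ` {1..r}) = lie_algebra A"
    and "subgroup \<Gamma>\<^sub>N (matrix_group N)" and "discrete \<Gamma>\<^sub>N"
    and "\<O> \<in> orbits (matrix_group Q) UNIV dual_action" and "open \<O>"
    and "closure \<O> - \<O> \<in> null_sets lebesgue"
    and "\<omega> \<in> \<O>"
    and "stabilizer (matrix_group Q) dual_action \<omega> \<subseteq> R"
  shows "separated (matrix_group Q) dual_action (top_of_set \<O>)
           {\<gamma> ** \<eta> | \<gamma> \<eta>. \<gamma> \<in> exp_lattice r H \<and> \<eta> \<in> \<Gamma>\<^sub>N}"
proof -
  let ?f = "\<lambda>(a, \<nu>, \<rho>). a ** \<nu> ** \<rho> :: real ^ 'n ^ 'n"

  \<comment> \<open>Group data and neighbourhoods of the identity\<close>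
  have Q: "subgroup Q GL" "closedin (top_of_set (carrier GL)) Q"
    using assms(1) by (auto simp: closed_matrix_group_def)
  have A: "subgroup A GL" and N: "subgroup N GL" and R: "subgroup R GL"
    using assms(2-4) by (simp_all add: lie_subgroup_def group.incl_subgroup[OF group_GL Q(1)])
  have \<Gamma>N: "subgroup \<Gamma>\<^sub>N GL" "\<Gamma>\<^sub>N \<subseteq> N"
    using group.incl_subgroup[OF group_GL N assms(16)] subgroup.subset[OF assms(16)] by simp_all
  note Q' = subgroup_GLD[OF Q(1)] and A' = subgroup_GLD[OF A] and N' = subgroup_GLD[OF N]
    and R' = subgroup_GLD[OF R] and \<Gamma>N' = subgroup_GLD[OF \<Gamma>N(1)]
  have AQ: "A \<subseteq> Q" and NQ: "N \<subseteq> Q" and RQ: "R \<subseteq> Q"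
    using assms(2-4)[unfolded lie_subgroup_def, THEN conjunct1, THEN subgroup.subset] by simp_all
  obtain g where g: "homeomorphism (A \<times> N \<times> R) Q ?f g"
    using assms(6) by (auto simp: diffeomorphism_def)
  have inj: "inj_on ?f (A \<times> N \<times> R)"
    using homeomorphism_apply1[OF g] by (rule inj_on_inverseI)
  have clo: "closedin (top_of_set (carrier GL)) A" "closedin (top_of_set (carrier GL)) N"
    using homeomorphism_mult_closedin_factors[OF g Q(2) A'(2) N'(2) R'(2)] .
  let ?L = "exp_lattice r H"
  have LA: "?L \<subseteq> A"
    using exp_lattice_discrete(1)[OF A clo(1) assms(12-15)] .
  obtain VA where VA: "open VA" "mat 1 \<in> VA"
    "\<And>\<gamma> \<gamma>'. \<gamma> \<in> ?L \<Longrightarrow> \<gamma>' \<in> ?L \<Longrightarrow> matrix_inv \<gamma>' ** \<gamma> \<in> VA \<Longrightarrow> \<gamma> = \<gamma>'"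
    using exp_lattice_discrete(2)[OF A clo(1) assms(12-15)] by blast
  \<comment> \<open>Isolating the identity suffices: quotients of elements of
    \<open>\<Gamma>\<^sub>N\<close> stay in this subgroup.\<close>
  obtain VN where VN: "open VN" "VN \<inter> \<Gamma>\<^sub>N = {mat 1}"
    using discreteD[OF assms(17) \<Gamma>N'(2)] by (auto simp: isolated_in_def)
  let ?G = "carrier GL :: (real ^ 'n ^ 'n) set"
  have G: "open ?G" "mat 1 \<in> ?G"
    using open_invertible_matrices[where 'n = 'n] by (auto simp: GL_def invertible_mat_1)
  \<comment> \<open>The last two conditions are the forms to which
    \<open>matrix_inv \<gamma>' ** \<gamma>\<close> and \<open>matrix_inv \<eta>' ** \<eta>\<close>
    will reduce. Both expressions are continuous and equal \<open>mat 1\<close> at the identity. The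
    ball inside GL serves compactness.\<close>
  obtain \<epsilon> where \<epsilon>: "\<epsilon> > 0" "cball (mat 1) \<epsilon> \<subseteq> ?G"
    "\<And>a b. a \<in> cball (mat 1) \<epsilon> \<Longrightarrow> b \<in> cball (mat 1) \<epsilon> \<Longrightarrow> a ** matrix_inv b \<in> VA"
    "\<And>a b c. a \<in> cball (mat 1) \<epsilon> \<Longrightarrow> b \<in> cball (mat 1) \<epsilon> \<Longrightarrow> c \<in> cball (mat 1) \<epsilon> \<Longrightarrow>
      a ** (b ** matrix_inv c) ** matrix_inv a \<in> VN"
  proof -
    let ?F = "\<lambda>(a, b, c). (a ** matrix_inv b, a ** (b ** matrix_inv c) ** matrix_inv a)
      :: (real ^ 'n ^ 'n) \<times> (real ^ 'n ^ 'n)"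
    have "continuous_on (?G \<times> ?G \<times> ?G) ?F"
      unfolding case_prod_beta by (intro continuous_intros) (auto simp: GL_def)
    then obtain e where e: "e > 0" "cball (mat 1, mat 1, mat 1) e \<subseteq> ?G \<times> ?G \<times> ?G"
      "\<And>y. y \<in> cball (mat 1, mat 1, mat 1) e \<Longrightarrow> ?F y \<in> VA \<times> VN"
      using G VA(1,2) VN
      by (elim continuous_nbhd_cball[where U = "VA \<times> VN"])
        (auto intro!: open_Times simp: matrix_inv_mat_1)
    \<comment> \<open>The product distance is at most the sum of the three distances, hence the
      radius \<open>e / 3\<close>.\<close>
    have mem: "(a, b, c) \<in> cball (mat 1, mat 1, mat 1) e"
      if "a \<in> cball (mat 1) (e / 3)" "b \<in> cball (mat 1) (e / 3)" "c \<in> cball (mat 1) (e / 3)"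
      for a b c :: "real ^ 'n ^ 'n"
    proof -
      have "dist (mat 1, mat 1, mat 1) (a, b, c) \<le> dist (mat 1) a + (dist (mat 1) b + dist (mat 1) c)"
        unfolding dist_Pair_Pair
        by (intro order_trans[OF sqrt_sum_squares_le_sum] add_left_mono) auto
      then show ?thesis
        using that by simp
    qed
    show thesis
    proof (rule that[of "e / 3"])
      show "cball (mat 1) (e / 3) \<subseteq> ?G"
        using mem e(2) by blast
      show "a ** matrix_inv b \<in> VA" if "a \<in> cball (mat 1) (e / 3)" "b \<in> cball (mat 1) (e / 3)" for a b
        using e(3)[OF mem[OF that that(1)]] by simp
      show "a ** (b ** matrix_inv c) ** matrix_inv a \<in> VN"
        if "a \<in> cball (mat 1) (e / 3)" "b \<in> cball (mat 1) (e / 3)" "c \<in> cball (mat 1) (e / 3)" for a b c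
        using e(3)[OF mem[OF that]] by simp
    qed (use e(1) in simp)
  qed

  \<comment> \<open>The compact set \<open>B\<close> and its interior\<close>
  define FA where "FA = A \<inter> cball (mat 1) \<epsilon>"
  define FN where "FN = N \<inter> cball (mat 1) \<epsilon>"
  \<comment> \<open>\<open>R\<close> enters whole: it is compact, and only the \<open>A\<close>- and
    \<open>N\<close>-components will be compared.\<close>
  define C where "C = ?f ` (FA \<times> FN \<times> R)"
  define B where "B = (\<lambda>q. dual_action q \<omega>) ` C"
  have "compact (FA \<times> FN \<times> R)"
    unfolding FA_def FN_def
    using compact_closedin_Int_cball[OF clo(1) \<epsilon>(2)] compact_closedin_Int_cball[OF clo(2) \<epsilon>(2)] assms(7)
    by (intro compact_Times)
  then have C: "compact C" "C \<subseteq> Q"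
    unfolding C_def using AQ NQ RQ Q'(3)
    by (auto intro!: compact_continuous_image continuous_intros simp: case_prod_beta FA_def FN_def subset_iff)
  \<comment> \<open>The orbit is given with some base point \<open>x\<close>; the element
    \<open>p\<close> carrying \<open>x\<close> to \<omega> moves the base point.\<close>
  have orb: "\<O> = (\<lambda>q. dual_action q \<omega>) ` Q"
  proof -
    obtain x where x: "\<O> = (\<lambda>q. dual_action q x) ` Q"
      using assms(18) by (auto simp: orbits_def orbit_def)
    obtain p where p: "p \<in> Q" "\<omega> = dual_action p x"
      using x assms(21) by blast
    have "dual_action q x \<in> (\<lambda>q. dual_action q \<omega>) ` Q" if "q \<in> Q" for q
    proof (rule image_eqI)
      show "q ** matrix_inv p \<in> Q"
        using that p(1) Q' by blast
      have "dual_action (q ** matrix_inv p) \<omega> = dual_action q (dual_action (matrix_inv p) \<omega>)"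
        using that p(1) Q' by (intro dual_action_mult) auto
      then show "dual_action q x = dual_action (q ** matrix_inv p) \<omega>"
        using p Q'(1) by (simp add: dual_action_inv_cancel)
    qed
    moreover have "dual_action q \<omega> \<in> \<O>" if "q \<in> Q" for q
    proof -
      have "dual_action q \<omega> = dual_action (q ** p) x"
        using that p Q'(1) by (simp add: dual_action_mult)
      then show ?thesis
        using x that p(1) Q'(3) by blast
    qed
    ultimately show ?thesis
      using x by blast
  qed
  \<comment> \<open>Open balls replace the closed ones of \<open>C\<close>, so this is the
    homeomorphic image of a relatively open set and is open in \<open>Q\<close>.\<close>
  define V where "V = ?f ` ((A \<inter> ball (mat 1) \<epsilon>) \<times> (N \<inter> ball (mat 1) \<epsilon>) \<times> R)"
  have "openin (top_of_set Q) V"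
    unfolding V_def
    by (rule homeomorphism_imp_open_map[OF g]) (auto intro!: openin_Times openin_open_Int)
  moreover have "V \<noteq> {}"
    using A'(2) N'(2) R'(2) \<epsilon>(1) by (force simp: V_def)
  moreover have "V \<subseteq> C"
    unfolding V_def C_def FA_def FN_def using ball_subset_cball by (intro image_mono) blast
  ultimately have int: "interior B \<noteq> {}"
    unfolding B_def using interior_orbit_image_nonempty[OF Q(1) assms(19) orb _ _ _ C] by blast
  have B: "compact B" "B \<subseteq> \<O>"
    using C Q'(1) orb unfolding B_def by (auto intro!: compact_continuous_image continuous_intros)

  \<comment> \<open>Disjointness of the translates of \<open>B\<close>\<close>
  let ?\<Gamma> = "{\<gamma> ** \<eta> | \<gamma> \<eta>. \<gamma> \<in> ?L \<and> \<eta> \<in> \<Gamma>\<^sub>N}"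
  have \<Gamma>Q: "?\<Gamma> \<subseteq> Q"
    using LA AQ \<Gamma>N(2) NQ Q'(3) by blast
  have key: "h = k" if hk: "h \<in> ?\<Gamma>" "k \<in> ?\<Gamma>" and xh: "x \<in> dual_action h ` B" and xk: "x \<in> dual_action k ` B" for h k x
  proof -
    obtain \<gamma> \<eta> \<gamma>' \<eta>' where h: "h = \<gamma> ** \<eta>" "\<gamma> \<in> ?L" "\<eta> \<in> \<Gamma>\<^sub>N" and k: "k = \<gamma>' ** \<eta>'" "\<gamma>' \<in> ?L" "\<eta>' \<in> \<Gamma>\<^sub>N"
      using hk by blast
    obtain a \<nu> \<rho> where x: "a \<in> FA" "\<nu> \<in> FN" "\<rho> \<in> R" "x = dual_action h (dual_action (a ** \<nu> ** \<rho>) \<omega>)"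
      using xh by (auto simp: B_def C_def)
    obtain a' \<nu>' \<rho>' where x': "a' \<in> FA" "\<nu>' \<in> FN" "\<rho>' \<in> R" "x = dual_action k (dual_action (a' ** \<nu>' ** \<rho>') \<omega>)"
      using xk by (auto simp: B_def C_def)
    have memA: "\<gamma> \<in> A" "\<gamma>' \<in> A" "a \<in> A" "a' \<in> A"
      using LA h k x x' by (auto simp: FA_def)
    have memN: "\<eta> \<in> N" "\<eta>' \<in> N" "\<nu> \<in> N" "\<nu>' \<in> N"
      using \<Gamma>N(2) h k x x' by (auto simp: FN_def)
    note inv = A'(1)[OF memA(1)] A'(1)[OF memA(2)] A'(1)[OF memA(3)] A'(1)[OF memA(4)]
      N'(1)[OF memN(1)] N'(1)[OF memN(2)] N'(1)[OF memN(3)] N'(1)[OF memN(4)] R'(1)[OF x(3)] R'(1)[OF x'(3)]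
    define p where "p = \<gamma> ** \<eta> ** (a ** \<nu> ** \<rho>)"
    define q where "q = \<gamma>' ** \<eta>' ** (a' ** \<nu>' ** \<rho>')"
    have pq: "p \<in> Q" "q \<in> Q"
      unfolding p_def q_def using memA memN x(3) x'(3) AQ NQ RQ by (auto intro!: Q'(3))
    have eq: "dual_action p \<omega> = dual_action q \<omega>"
      using x(4) x'(4) inv by (simp add: p_def q_def h k dual_action_mult invertible_mult)
    define s where "s = matrix_inv q ** p"
    have "dual_action s \<omega> = \<omega>"
      using pq Q' eq by (simp add: s_def dual_action_mult dual_action_inv_cancel)
    moreover have "s \<in> Q"
      using pq Q' by (simp add: s_def)
    ultimately have s: "s \<in> R"
      using assms(22) by (auto simp: stabilizer_def)
    \<comment> \<open>Normalization is applied to the inverse of \<open>b\<close>, which reverses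
      the direction of the conjugation.\<close>
    have conj: "matrix_inv b ** \<theta> ** b \<in> N" if "b \<in> A" "\<theta> \<in> N" for b \<theta>
    proof -
      have "(\<lambda>\<nu>. matrix_inv b ** \<nu> ** matrix_inv (matrix_inv b)) ` N = N"
        using assms(11) A'(4)[OF that(1)] unfolding normalizes_def by blast
      then show ?thesis
        using that(2) matrix_inv_matrix_inv[OF A'(1)[OF that(1)]] by auto
    qed
    \<comment> \<open>The coordinates of \<open>p\<close> and \<open>q ** s\<close> in the product:
      moving \<open>a\<close> left past \<eta> conjugates \<eta>, which stays in \<open>N\<close>,
      and the stabilizer element \<open>s\<close> is absorbed by the factor
      \<open>R\<close>.\<close>
    let ?t = "(\<gamma> ** a, matrix_inv a ** \<eta> ** a ** \<nu>, \<rho>)"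
    let ?t' = "(\<gamma>' ** a', matrix_inv a' ** \<eta>' ** a' ** \<nu>', \<rho>' ** s)"
    have "?t \<in> A \<times> N \<times> R" "?t' \<in> A \<times> N \<times> R"
      using memA memN conj A'(3) N'(3) R'(3) x(3) x'(3) s by simp_all
    moreover have "?f ?t = ?f ?t'"
    proof -
      have "?f ?t = p"
        using inv by (simp add: p_def matrix_inv_cancel_right flip: matrix_mul_assoc)
      moreover have "?f ?t' = q ** s"
        using inv by (simp add: q_def matrix_inv_cancel_right flip: matrix_mul_assoc)
      moreover have "q ** s = p"
        using Q'(1)[OF pq(2)] by (simp add: s_def matrix_inv_cancel_right)
      ultimately show ?thesis
        by (simp only:)
    qed
    ultimately have "?t = ?t'"
      using inj_on_eq_iff[OF inj] by blast
    then have eqA: "\<gamma> ** a = \<gamma>' ** a'" and eqN: "matrix_inv a ** \<eta> ** a ** \<nu> = matrix_inv a' ** \<eta>' ** a' ** \<nu>'"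
      by simp_all
    have "matrix_inv \<gamma>' ** \<gamma> = matrix_inv \<gamma>' ** (\<gamma> ** a) ** matrix_inv a"
      using inv by (simp add: matrix_inv_right flip: matrix_mul_assoc)
    also have "\<dots> = a' ** matrix_inv a"
      unfolding eqA using inv by (simp add: matrix_inv_cancel_left)
    also have "\<dots> \<in> VA"
      using x(1) x'(1) by (auto simp: FA_def intro!: \<epsilon>(3))
    finally have \<gamma>: "\<gamma> = \<gamma>'"
      using VA(3) h(2) k(2) by blast
    then have a: "a = a'"
      using eqA matrix_inv_cancel_left[OF inv(2)] by metis
    \<comment> \<open>Left multiplication by \<open>a\<close> undoes the conjugation on both sides
      of \<open>eqN\<close>, because \<open>a = a'\<close>.\<close>
    have "\<eta> ** (a ** \<nu>) = a ** (matrix_inv a ** \<eta> ** a ** \<nu>)"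
      using inv by (simp add: matrix_inv_cancel_right flip: matrix_mul_assoc)
    also have "\<dots> = \<eta>' ** (a ** \<nu>')"
      unfolding eqN using inv a by (simp add: matrix_inv_cancel_right flip: matrix_mul_assoc)
    finally have eq': "\<eta> ** (a ** \<nu>) = \<eta>' ** (a ** \<nu>')" .
    have "matrix_inv \<eta>' ** \<eta> = matrix_inv \<eta>' ** (\<eta> ** (a ** \<nu>)) ** (matrix_inv \<nu> ** matrix_inv a)"
      using inv by (simp add: matrix_inv_right matrix_inv_cancel_right flip: matrix_mul_assoc)
    also have "\<dots> = a ** (\<nu>' ** matrix_inv \<nu>) ** matrix_inv a"
      unfolding eq' using inv by (simp add: matrix_inv_cancel_left matrix_mul_assoc[symmetric])
    also have "\<dots> \<in> VN"
      using x(1,2) x'(2) by (auto simp: FA_def FN_def intro!: \<epsilon>(4))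
    finally have "matrix_inv \<eta>' ** \<eta> \<in> VN" .
    moreover have "matrix_inv \<eta>' ** \<eta> \<in> \<Gamma>\<^sub>N"
      using h(3) k(3) \<Gamma>N'(3,4) by blast
    ultimately have "matrix_inv \<eta>' ** \<eta> = mat 1"
      using VN(2) by blast
    then have "\<eta> = \<eta>'"
      using matrix_inv_cancel_right[OF inv(6), of \<eta>] by simp
    then show ?thesis
      using h k \<gamma> by simp
  qed
  \<comment> \<open>As the orbit is open, interior points in the whole space are interior points
    relative to the orbit.\<close>
  have "top_of_set \<O> interior_of B \<noteq> {}"
    using int interior_subset[of B] B(2) assms(19) by (auto simp: interior_of_subtopology_open)
  then have "separated_by (matrix_group Q) dual_action (top_of_set \<O>) ?\<Gamma> B"
    unfolding separated_by_def
  proof (intro conjI ballI impI)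
    show "?\<Gamma> \<subseteq> carrier (matrix_group Q)"
      using \<Gamma>Q by simp
    show "compactin (top_of_set \<O>) B"
      using B by (simp add: compactin_subtopology)
    show "dual_action h ` B \<inter> dual_action k ` B = {}" if "h \<in> ?\<Gamma>" "k \<in> ?\<Gamma>" "h \<noteq> k" for h k
      using key[OF that(1,2)] that(3) by blast
  qed
  then show ?thesis
    unfolding separated_def by blast
qed

end
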